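(* For any $0 < m \le M < \infty$ there is no nonnegative, Lebesgue measurable function $f:\mathbb{R}^2 \to \mathbb{R}$ such that for every strip $S$ of width $1$ in the plane $$m \le \int_S f \le M.$$
   Context: A strip of width $1$ in the plane is the region between two parallel lines at distance $1$, i.e. a set of the form $\{x \in \mathbb{R}^2 : a \le x \cdot u \le a + 1\}$ with $u$ a unit vector in $\mathbb{R}^2$ and $a \in \mathbb{R}$. The integral $\int_S f$ is with respect to two-dimensional Lebesgue measure. *)

theory Defs
  imports "HOL-Analysis.Analysis"
begin

definition unit_width_strip :: "(real^2) set \<Rightarrow> bool" where
  "unit_width_strip S \<longleftrightarrow>
    (\<exists>u a. norm u = 1 \<and> S = {x. a \<le> x \<bullet> u \<and> x \<bullet> u \<le> a + 1})"

end

theory Submission imports Defs begin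

text \<open>
  Average the hypothesis over all directions: let \<open>v\<close> range over the punctured unit disc \<open>D\<close>, with
  \<open>v / norm v\<close> as the normal of the strip, and let \<open>\<mu>\<close> be the measure with density \<open>f\<close>.
  A point \<open>x\<close> with \<open>norm x \<ge> 1\<close> lies in the strip \<open>[0, 1]\<close> for a set of normals \<open>v\<close> of area at
  least \<open>1 / (8 * norm x)\<close>, so the upper bound \<open>M\<close> makes \<open>1 / norm x\<close> integrable over
  \<open>norm x \<ge> 1\<close> with respect to \<open>\<mu>\<close>. On the other hand the slab \<open>[2 * n, 4 * n]\<close> contains \<open>n\<close>
  disjoint strips, so its measure is at least \<open>n * m\<close>, while \<open>x\<close> lies in it only if
  \<open>norm x \<ge> 2 * n\<close>, and then for a set of normals of area at most \<open>16 * n / norm x\<close>. Hence \<open>m\<close> times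
  the area of \<open>D\<close> is at most 16 times the integral of \<open>1 / norm x\<close> over \<open>norm x \<ge> 2 * n\<close>, a tail
  that tends to 0.
\<close>

section \<open>Areas of sets of normals\<close>

text \<open>The condition on \<open>x \<bullet> (v / norm v)\<close> is multiplied by
  \<open>norm v\<close>. Taking \<open>v\<close> in a disc instead of on the circle makes planar
  Lebesgue measure the measure on directions. The origin, which has no direction, would satisfy both
  inequalities for every \<open>x\<close>.\<close>

definition slab_normals :: "real^2 \<Rightarrow> real \<Rightarrow> real \<Rightarrow> (real^2) set" where
  "slab_normals x c d = {v \<in> ball 0 1 - {0}. c * norm v \<le> x \<bullet> v \<and> x \<bullet> v \<le> d * norm v}"

lemma slab_normals_borel [measurable]: "slab_normals x c d \<in> sets borel"
  unfolding slab_normals_def by measurable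

lemma slab_normals_lmeasurable: "slab_normals x c d \<in> lmeasurable"
proof (rule bounded_set_imp_lmeasurable)
  show "bounded (slab_normals x c d)"
    by (rule bounded_subset[OF bounded_ball[of 0 1]]) (auto simp: slab_normals_def)
qed (simp add: slab_normals_borel)

lemma emeasure_slab_normals:
  "emeasure lborel (slab_normals x c d) = ennreal (measure lebesgue (slab_normals x c d))"
  using emeasure_eq_measure2[OF slab_normals_lmeasurable] by simp

text \<open>A rotation preserves norms, inner products and area. This reduces the area estimates to
  \<open>x\<close> on the first axis, where \<open>x \<bullet> v\<close> is
  \<open>norm x * v$1\<close>.\<close>

lemma measure_slab_normals_rotate:
  "measure lebesgue (slab_normals x c d) = measure lebesgue (slab_normals (norm x *\<^sub>R axis 1 1) c d)"
proof -
  obtain R :: "real^2 \<Rightarrow> real^2" where R: "orthogonal_transformation R" "R (norm x *\<^sub>R axis 1 1) = x"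
    by (rule rotation_rightward_line[of x 1]) blast
  let ?y = "norm x *\<^sub>R axis 1 1 :: real^2"
  have nR: "norm (R w) = norm w" for w
    using R(1) by (rule orthogonal_transformation_norm)
  have iR: "x \<bullet> R w = ?y \<bullet> w" for w
    using R by (metis orthogonal_transformation_def)
  have "surj R" using R(1) by (rule orthogonal_transformation_surj)
  have mem: "R w \<in> slab_normals x c d \<longleftrightarrow> w \<in> slab_normals ?y c d" for w
  proof -
    have "R w = 0 \<longleftrightarrow> w = 0" using nR[of w] by (metis norm_eq_zero)
    then show ?thesis
      by (simp only: slab_normals_def mem_Collect_eq Diff_iff mem_ball_0 singleton_iff nR iR)
  qed
  have "R ` slab_normals ?y c d = slab_normals x c d"
  proof (intro equalityI subsetI)
    fix v assume v: "v \<in> slab_normals x c d"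
    obtain w where w: "v = R w" using \<open>surj R\<close> by (metis surjD)
    show "v \<in> R ` slab_normals ?y c d" using v mem[of w] unfolding w by blast
  qed (use mem in blast)
  then show ?thesis
    using measure_orthogonal_image[OF R(1) slab_normals_lmeasurable] by metis
qed

lemma measure_cbox_vec2:
  fixes a b :: "real^2"
  assumes "a $ 1 \<le> b $ 1" "a $ 2 \<le> b $ 2"
  shows "measure lebesgue (cbox a b) = (b $ 1 - a $ 1) * (b $ 2 - a $ 2)"
proof -
  have "cbox a b \<noteq> {}"
    using assms by (auto simp: interval_ne_empty_cart forall_2 not_less)
  then show ?thesis
    by (simp add: measure_completion content_cbox_cart UNIV_2)
qed

lemma norm_vec2: "norm (v::real^2) = sqrt ((v$1)\<^sup>2 + (v$2)\<^sup>2)"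
  by (simp add: norm_vec_def L2_set_def UNIV_2)

text \<open>The set contains a box of width \<open>1 / (2 * norm x)\<close> and height 1/4. On it
  \<open>v$2 \<ge> 1/2\<close> gives \<open>norm x * v$1 \<le> 1/2 \<le> norm v\<close>, and 1/4 +
  9/16 < 1 keeps it in the disc.\<close>

lemma measure_slab_normals_ge:
  assumes "norm x \<ge> 1"
  shows "measure lebesgue (slab_normals x 0 1) \<ge> 1 / (8 * norm x)"
proof -
  let ?r = "norm x"
  let ?B = "cbox (vector [0, 1/2]) (vector [1 / (2 * ?r), 3/4]) :: (real^2) set"
  have "?B \<subseteq> slab_normals (?r *\<^sub>R axis 1 1) 0 1"
  proof
    fix v assume "v \<in> ?B"
    then have v: "0 \<le> v$1" "v$1 \<le> 1/(2*?r)" "1/2 \<le> v$2" "v$2 \<le> 3/4"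
      by (auto simp: mem_box_cart forall_2)
    have "1/(2*?r) \<le> 1/2" using assms by (simp add: divide_simps)
    then have "v$1 \<le> 1/2" using v by linarith
    then have "(v$1)\<^sup>2 \<le> (1/2)\<^sup>2" "(v$2)\<^sup>2 \<le> (3/4)\<^sup>2"
      using v by (intro power_mono; simp)+
    then have "norm v < 1" unfolding norm_vec2 by (simp add: power2_eq_square)
    moreover have n: "1/2 \<le> norm v"
      using component_le_norm_cart[of v 2] v by linarith
    moreover have "?r * v$1 \<le> ?r * (1/(2*?r))" using v by (intro mult_left_mono) auto
    then have "?r * v$1 \<le> 1/2" using assms by (auto split: if_splits)
    moreover have "v \<noteq> 0" using n by auto
    ultimately show "v \<in> slab_normals (?r *\<^sub>R axis 1 1) 0 1"
      using v by (auto simp: slab_normals_def inner_axis')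
  qed
  then have "measure lebesgue ?B \<le> measure lebesgue (slab_normals (?r *\<^sub>R axis 1 1) 0 1)"
    by (intro measure_mono_fmeasurable slab_normals_lmeasurable) auto
  moreover have "measure lebesgue ?B = 1 / (8 * ?r)"
    using assms by (subst measure_cbox_vec2) (auto simp: field_simps)
  ultimately show ?thesis by (simp flip: measure_slab_normals_rotate)
qed

text \<open>As \<open>norm v < 1\<close>, the first coordinate is confined to
  \<open>[0, d / norm x]\<close>; a symmetric box of height 2 covers this.\<close>

lemma measure_slab_normals_le:
  assumes "x \<noteq> 0" "0 \<le> c" "0 \<le> d"
  shows "measure lebesgue (slab_normals x c d) \<le> 4 * d / norm x"
proof -
  let ?r = "norm x"
  let ?B = "cbox (vector [- (d / ?r), -1]) (vector [d / ?r, 1]) :: (real^2) set"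
  have r: "?r > 0" using assms by simp
  have "slab_normals (?r *\<^sub>R axis 1 1) c d \<subseteq> ?B"
  proof
    fix v assume "v \<in> slab_normals (?r *\<^sub>R axis 1 1) c d"
    then have v: "norm v < 1" "c * norm v \<le> ?r * v$1" "?r * v$1 \<le> d * norm v"
      by (auto simp: slab_normals_def inner_axis')
    have "\<bar>v$2\<bar> \<le> 1" using component_le_norm_cart[of v 2] v by linarith
    moreover have "0 \<le> c * norm v" using assms by simp
    then have "0 \<le> v$1" using v r by (metis order_trans zero_le_mult_iff not_le)
    moreover have "d * norm v \<le> d * 1" using v assms by (intro mult_left_mono) auto
    then have "v$1 \<le> d / ?r" using v r by (simp add: field_simps)
    moreover have "0 \<le> d / ?r" using assms by simp
    ultimately show "v \<in> ?B"
      by (auto simp: mem_box_cart forall_2)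
  qed
  then have "measure lebesgue (slab_normals (?r *\<^sub>R axis 1 1) c d) \<le> measure lebesgue ?B"
    by (intro measure_mono_fmeasurable) (auto simp: slab_normals_lmeasurable fmeasurableD)
  moreover have "measure lebesgue ?B = 4 * d / ?r"
    using assms by (subst measure_cbox_vec2) (auto simp: field_simps)
  ultimately show ?thesis by (simp flip: measure_slab_normals_rotate)
qed

text \<open>By Cauchy-Schwarz, a slab at distance \<open>c\<close> from the origin misses all points
  closer than \<open>c\<close>.\<close>

lemma slab_normals_empty:
  assumes "norm x < c"
  shows "slab_normals x c d = {}"
proof -
  have False if "v \<noteq> 0" "c * norm v \<le> x \<bullet> v" for v
  proof -
    have "x \<bullet> v \<le> norm x * norm v" by (rule norm_cauchy_schwarz)
    also have "\<dots> < c * norm v" using assms that by simp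
    finally show False using that by simp
  qed
  then show ?thesis by (auto simp: slab_normals_def)
qed

section \<open>Exchanging points and normals\<close>

lemma slab_normals_pred [measurable]:
  "Measurable.pred (borel \<Otimes>\<^sub>M borel) (\<lambda>z. snd z \<in> slab_normals (fst z) c d)"
proof -
  have "(\<lambda>z. snd z \<in> slab_normals (fst z) c d) =
    (\<lambda>z. norm (snd z) < 1 \<and> snd z \<noteq> 0 \<and> c * norm (snd z) \<le> fst z \<bullet> snd z
       \<and> fst z \<bullet> snd z \<le> d * norm (snd z))"
    by (auto simp: slab_normals_def fun_eq_iff)
  then show ?thesis by simp
qed

lemma emeasure_slab_normals_measurable [measurable]:
  "(\<lambda>x. emeasure lborel (slab_normals x c d)) \<in> borel_measurable borel"
proof -
  have "{z \<in> space (borel \<Otimes>\<^sub>M lborel). snd z \<in> slab_normals (fst z) c d}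
      \<in> sets (borel \<Otimes>\<^sub>M lborel)"
    by measurable
  from lborel.measurable_emeasure_Pair[OF this] show ?thesis
    by (simp add: vimage_def space_pair_measure)
qed

text \<open>Tonelli for the incidence relation between points and normals: integrating slab masses
  over all normals weights each point by the area of its normals.\<close>

lemma nn_integral_slab_normals:
  fixes g :: "real^2 \<Rightarrow> ennreal"
  assumes [measurable]: "g \<in> borel_measurable borel"
  shows "(\<integral>\<^sup>+x. emeasure lborel (slab_normals x c d) \<partial>density lborel g) =
    (\<integral>\<^sup>+v\<in>ball 0 1 - {0}.
       emeasure (density lborel g) {x. c * norm v \<le> x \<bullet> v \<and> x \<bullet> v \<le> d * norm v} \<partial>lborel)"
proof -
  have "(\<integral>\<^sup>+x. emeasure lborel (slab_normals x c d) \<partial>density lborel g) =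
      (\<integral>\<^sup>+x. (\<integral>\<^sup>+v. g x * indicator (slab_normals x c d) v \<partial>lborel) \<partial>lborel)"
    by (simp add: nn_integral_density nn_integral_cmult_indicator)
  also have "\<dots> = (\<integral>\<^sup>+v. (\<integral>\<^sup>+x. g x * indicator (slab_normals x c d) v \<partial>lborel) \<partial>lborel)"
    \<comment> \<open>With the indicator as a conditional, joint measurability comes from
      \<open>slab_normals_pred\<close>.\<close>
    unfolding indicator_def by (rule lborel_pair.Fubini'[symmetric]) measurable
  also have "\<dots> = (\<integral>\<^sup>+v\<in>ball 0 1 - {0}.
       emeasure (density lborel g) {x. c * norm v \<le> x \<bullet> v \<and> x \<bullet> v \<le> d * norm v} \<partial>lborel)"
  proof (rule nn_integral_cong)
    fix v :: "real^2"
    show "(\<integral>\<^sup>+x. g x * indicator (slab_normals x c d) v \<partial>lborel) =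
      emeasure (density lborel g) {x. c * norm v \<le> x \<bullet> v \<and> x \<bullet> v \<le> d * norm v}
        * indicator (ball 0 1 - {0}) v"
      by (subst emeasure_density)
        (auto simp: slab_normals_def indicator_def intro!: nn_integral_cong)
  qed
  finally show ?thesis .
qed

lemma unit_width_strip_normal:
  assumes "v \<noteq> 0"
  shows "unit_width_strip {x. a * norm v \<le> x \<bullet> v \<and> x \<bullet> v \<le> (a + 1) * norm v}"
  unfolding unit_width_strip_def
  using assms
  by (intro exI[of _ "v /\<^sub>R norm v"] exI[of _ a]) (auto simp: field_simps)

section \<open>Contradiction for a Borel density\<close>

lemma no_borel_density:
  fixes g :: "real^2 \<Rightarrow> ennreal"
  assumes [measurable]: "g \<in> borel_measurable borel" and "0 < m"
    and lower: "\<And>S. unit_width_strip S \<Longrightarrow> ennreal m \<le> emeasure (density lborel g) S"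
    and upper: "\<And>S. unit_width_strip S \<Longrightarrow> emeasure (density lborel g) S \<le> ennreal M"
  shows False
proof -
  define \<mu> where "\<mu> = density lborel g"
  define D where "D = (ball 0 1 - {0} :: (real^2) set)"
  define strip where "strip v c d = {x::real^2. c * norm v \<le> x \<bullet> v \<and> x \<bullet> v \<le> d * norm v}"
    for v c d
  \<comment> \<open>Finiteness of \<open>\<rho>\<close> is the integrability of
    \<open>1 / norm x\<close> away from the origin.\<close>
  define \<rho> where "\<rho> = density \<mu> (\<lambda>x. ennreal (1 / norm x) * indicator {x. 1 \<le> norm x} x)"
  \<comment> \<open>\<open>Suc n\<close> keeps the tail inside \<open>norm x \<ge> 1\<close> and the
    number of strips positive.\<close>
  define tail where "tail n = {x::real^2. 2 * real (Suc n) \<le> norm x}" for n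
  have sets_\<mu> [measurable_cong]: "sets \<mu> = sets borel" by (simp add: \<mu>_def)
  have sets_\<rho> [measurable_cong]: "sets \<rho> = sets borel" by (simp add: \<rho>_def sets_\<mu>)
  have [measurable]: "D \<in> sets borel" by (simp add: D_def)
  have [measurable]: "strip v c d \<in> sets borel" for v c d
    unfolding strip_def by measurable
  have [measurable]: "tail n \<in> sets borel" for n
    unfolding tail_def by measurable
  have fubini: "(\<integral>\<^sup>+x. emeasure lborel (slab_normals x c d) \<partial>\<mu>) =
      (\<integral>\<^sup>+v\<in>D. emeasure \<mu> (strip v c d) \<partial>lborel)" for c d
    unfolding \<mu>_def D_def strip_def by (rule nn_integral_slab_normals) measurable
  have D_fin: "emeasure lborel D < \<infinity>"
    unfolding D_def by (rule le_less_trans[OF emeasure_mono[of _ "ball 0 1"] emeasure_lborel_ball_finite]) auto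
  have D_pos: "emeasure lborel D > 0"
  proof -
    have "0 < emeasure lborel (ball (0::real^2) 1)"
      using content_ball_pos[of 1 "0::real^2"] by (simp add: measure_def enn2real_positive_iff)
    then show ?thesis
      unfolding D_def by (subst emeasure_Diff_null_set) auto
  qed
  have "emeasure \<rho> UNIV = (\<integral>\<^sup>+x. ennreal (1 / norm x) * indicator {x. 1 \<le> norm x} x \<partial>\<mu>)"
    unfolding \<rho>_def by (subst emeasure_density) auto
  \<comment> \<open>The factor 8 inverts the constant in
    \<open>measure_slab_normals_ge\<close>.\<close>
  also have "\<dots> \<le> (\<integral>\<^sup>+x. 8 * emeasure lborel (slab_normals x 0 1) \<partial>\<mu>)"
  proof (rule nn_integral_mono)
    fix x :: "real^2"
    have "ennreal (1 / norm x) \<le> 8 * emeasure lborel (slab_normals x 0 1)" if "1 \<le> norm x"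
    proof -
      have "ennreal (1 / norm x) = ennreal (8 * (1 / (8 * norm x)))" by simp
      also have "\<dots> \<le> ennreal (8 * measure lebesgue (slab_normals x 0 1))"
        using measure_slab_normals_ge[OF that] by (intro ennreal_leI) linarith
      also have "\<dots> = 8 * emeasure lborel (slab_normals x 0 1)"
        by (simp add: emeasure_slab_normals ennreal_mult)
      finally show ?thesis .
    qed
    then show "ennreal (1 / norm x) * indicator {x. 1 \<le> norm x} x \<le> 8 * emeasure lborel (slab_normals x 0 1)"
      by (auto simp: indicator_def)
  qed
  also have "\<dots> = 8 * (\<integral>\<^sup>+v\<in>D. emeasure \<mu> (strip v 0 1) \<partial>lborel)"
    by (subst nn_integral_cmult) (auto simp: fubini)
  also have "(\<integral>\<^sup>+v\<in>D. emeasure \<mu> (strip v 0 1) \<partial>lborel) \<le> (\<integral>\<^sup>+v\<in>D. ennreal M \<partial>lborel)"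
    using upper[OF unit_width_strip_normal[of _ 0]]
    by (intro nn_integral_mono) (auto simp: D_def strip_def \<mu>_def indicator_def)
  also have "\<dots> = ennreal M * emeasure lborel D"
    by (simp add: nn_integral_cmult_indicator)
  finally have "emeasure \<rho> UNIV \<le> 8 * (ennreal M * emeasure lborel D)"
    by (simp add: mult_left_mono)
  also have "\<dots> < \<infinity>" using D_fin by (simp add: ennreal_mult_less_top)
  finally have \<rho>_fin: "emeasure \<rho> UNIV < \<infinity>" .
  \<comment> \<open>Continuity from above, available because \<open>\<rho>\<close> is
    finite.\<close>
  have "(\<lambda>n. emeasure \<rho> (tail n)) \<longlonglongrightarrow> emeasure \<rho> (\<Inter>n. tail n)"
  proof (rule Lim_emeasure_decseq)
    show "decseq tail" by (force simp: decseq_def tail_def)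
    show "emeasure \<rho> (tail n) \<noteq> \<infinity>" for n
      using \<rho>_fin emeasure_mono[of "tail n" UNIV \<rho>] by (auto simp: sets_\<rho> top_unique)
  qed (auto simp: sets_\<rho>)
  also have "(\<Inter>n. tail n) = {}"
  proof -
    have False if "\<forall>n. x \<in> tail n" for x
    proof -
      obtain n where "norm x < real n" using reals_Archimedean2 by blast
      with that[rule_format, of n] show False by (simp add: tail_def)
    qed
    then show ?thesis by blast
  qed
  finally have lim: "(\<lambda>n. emeasure \<rho> (tail n)) \<longlonglongrightarrow> 0" by simp
  have slab_ge: "ennreal (real (Suc n)) * ennreal m \<le> emeasure \<mu> (strip v (2 * real (Suc n)) (4 * real (Suc n)))"
    if "v \<in> D" for v n
  proof -
    let ?N = "Suc n"
    \<comment> \<open>Starting at even offsets leaves gaps of width 1, so even the closed strips are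
      disjoint. The \<open>?N\<close> indices from \<open>?N\<close> to \<open>2 * ?N - 1\<close>
      end at offset \<open>4 * ?N - 1\<close>.\<close>
    let ?S = "\<lambda>k. strip v (2 * real k) (2 * real k + 1)"
    have v: "v \<noteq> 0" using that by (simp add: D_def)
    \<comment> \<open>A common point gives \<open>2 * k \<le> 2 * l + 1\<close>, hence
      \<open>k \<le> l\<close> for integers; by symmetry the indices agree.\<close>
    have *: "k \<le> l" if "x \<in> ?S k" "x \<in> ?S l" for x k l
    proof -
      have "2 * real k * norm v \<le> (2 * real l + 1) * norm v"
        using that by (auto simp: strip_def)
      then show ?thesis using v by simp
    qed
    have disj: "disjoint_family_on ?S {?N..<2*?N}"
      unfolding disjoint_family_on_def using * by (meson antisym disjoint_iff)
    have "ennreal (real ?N) * ennreal m = (\<Sum>k\<in>{?N..<2*?N}. ennreal m)"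
      by (simp add: ennreal_of_nat_eq_real_of_nat)
    also have "\<dots> \<le> (\<Sum>k\<in>{?N..<2*?N}. emeasure \<mu> (?S k))"
      unfolding \<mu>_def strip_def by (intro sum_mono lower unit_width_strip_normal v)
    also have "\<dots> = emeasure \<mu> (\<Union>k\<in>{?N..<2*?N}. ?S k)"
      using disj by (intro sum_emeasure) (auto simp: sets_\<mu>)
    also have "\<dots> \<le> emeasure \<mu> (strip v (2 * real ?N) (4 * real ?N))"
    proof (rule emeasure_mono)
      show "(\<Union>k\<in>{?N..<2*?N}. ?S k) \<subseteq> strip v (2 * real ?N) (4 * real ?N)"
      proof (rule UN_least)
        fix k assume k: "k \<in> {?N..<2*?N}"
        have "2 * real ?N \<le> 2 * real k" "2 * real k + 1 \<le> 4 * real ?N"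
          using k by auto
        then have "2 * real ?N * norm v \<le> 2 * real k * norm v"
          "(2 * real k + 1) * norm v \<le> 4 * real ?N * norm v"
          by (simp_all add: mult_right_mono del: of_nat_Suc)
        then show "?S k \<subseteq> strip v (2 * real ?N) (4 * real ?N)"
          unfolding strip_def by fastforce
      qed
    qed (simp add: sets_\<mu>)
    finally show ?thesis .
  qed
  \<comment> \<open>Both the number of strips and the area bound are linear in \<open>?N\<close>, so
    \<open>?N\<close> cancels and a bound uniform in \<open>n\<close> remains.\<close>
  have bound: "ennreal m * emeasure lborel D \<le> 16 * emeasure \<rho> (tail n)" for n
  proof -
    let ?N = "real (Suc n)"
    have "ennreal ?N * (ennreal m * emeasure lborel D) = (\<integral>\<^sup>+v\<in>D. ennreal ?N * ennreal m \<partial>lborel)"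
      by (subst nn_integral_cmult_indicator) (simp_all only: mult.assoc, measurable)
    also have "\<dots> \<le> (\<integral>\<^sup>+v\<in>D. emeasure \<mu> (strip v (2 * ?N) (4 * ?N)) \<partial>lborel)"
      using slab_ge[of _ n] by (intro nn_integral_mono) (auto simp: indicator_def)
    also have "\<dots> = (\<integral>\<^sup>+x. emeasure lborel (slab_normals x (2 * ?N) (4 * ?N)) \<partial>\<mu>)"
      by (simp only: fubini)
    also have "\<dots> \<le> (\<integral>\<^sup>+x. ennreal (16 * ?N) *
        (ennreal (1 / norm x) * indicator {x. 1 \<le> norm x} x * indicator (tail n) x) \<partial>\<mu>)"
    proof (rule nn_integral_mono)
      fix x :: "real^2"
      show "emeasure lborel (slab_normals x (2 * ?N) (4 * ?N)) \<le>
        ennreal (16 * ?N) * (ennreal (1 / norm x) * indicator {x. 1 \<le> norm x} x * indicator (tail n) x)"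
      proof (cases "norm x < 2 * ?N")
        case True
        then show ?thesis by (simp only: slab_normals_empty) simp
      next
        case False
        then have x: "x \<in> tail n" "1 \<le> norm x" "x \<noteq> 0" by (auto simp: tail_def)
        have "measure lebesgue (slab_normals x (2 * ?N) (4 * ?N)) \<le> 4 * (4 * ?N) / norm x"
          using x by (intro measure_slab_normals_le) auto
        also have "\<dots> = 16 * ?N * (1 / norm x)" by simp
        finally have "emeasure lborel (slab_normals x (2 * ?N) (4 * ?N)) \<le> ennreal (16 * ?N * (1 / norm x))"
          unfolding emeasure_slab_normals by (rule ennreal_leI)
        also have "\<dots> = ennreal (16 * ?N) * ennreal (1 / norm x)"
          by (rule ennreal_mult) auto
        finally show ?thesis using x by simp
      qed
    qed
    also have "\<dots> = ennreal (16 * ?N) * emeasure \<rho> (tail n)"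
      unfolding \<rho>_def by (subst nn_integral_cmult) (auto simp: emeasure_density)
    also have "\<dots> = ennreal ?N * (16 * emeasure \<rho> (tail n))"
      by (simp add: ennreal_mult ac_simps del: of_nat_Suc)
    finally show ?thesis
      by (subst (asm) ennreal_mult_le_mult_iff) (auto simp del: of_nat_Suc)
  qed
  have "(\<lambda>n. 16 * emeasure \<rho> (tail n)) \<longlonglongrightarrow> 16 * 0"
    by (intro ennreal_tendsto_cmult lim) simp
  \<comment> \<open>The left side does not depend on \<open>n\<close>, so it is at most the limit
    0.\<close>
  then have "ennreal m * emeasure lborel D \<le> 16 * 0"
    by (rule LIMSEQ_le_const) (use bound in auto)
  with \<open>0 < m\<close> D_pos show False by simp
qed

section \<open>From Lebesgue to Borel measurable functions\<close>

theorem corollary3: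
  fixes m M :: real
  assumes "0 < m" and "m \<le> M"
  shows "\<not> (\<exists>f :: real^2 \<Rightarrow> real.
           f \<in> borel_measurable lebesgue \<and> (\<forall>x. 0 \<le> f x) \<and>
           (\<forall>S. unit_width_strip S \<longrightarrow>
              ennreal m \<le> (\<integral>\<^sup>+x\<in>S. ennreal (f x) \<partial>lebesgue) \<and>
              (\<integral>\<^sup>+x\<in>S. ennreal (f x) \<partial>lebesgue) \<le> ennreal M))"
proof
  assume "\<exists>f :: real^2 \<Rightarrow> real.
           f \<in> borel_measurable lebesgue \<and> (\<forall>x. 0 \<le> f x) \<and>
           (\<forall>S. unit_width_strip S \<longrightarrow>
              ennreal m \<le> (\<integral>\<^sup>+x\<in>S. ennreal (f x) \<partial>lebesgue) \<and>
              (\<integral>\<^sup>+x\<in>S. ennreal (f x) \<partial>lebesgue) \<le> ennreal M)"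
  then obtain f :: "real^2 \<Rightarrow> real" where f: "f \<in> borel_measurable lebesgue"
    and bounds: "\<And>S. unit_width_strip S \<Longrightarrow> ennreal m \<le> (\<integral>\<^sup>+x\<in>S. ennreal (f x) \<partial>lebesgue)"
      "\<And>S. unit_width_strip S \<Longrightarrow> (\<integral>\<^sup>+x\<in>S. ennreal (f x) \<partial>lebesgue) \<le> ennreal M"
    by blast
  have "(\<lambda>x. ennreal (f x)) \<in> borel_measurable lebesgue" using f by measurable
  \<comment> \<open>Tonelli is applied to a Borel representative \<open>g\<close>. Since it agrees
    with \<open>f\<close> almost everywhere, all strip integrals are unchanged.\<close>
  then obtain g where g: "g \<in> borel_measurable lborel" and fg: "AE x in lborel. ennreal (f x) = g x"
    using completion_ex_borel_measurable by blast
  have eq: "(\<integral>\<^sup>+x\<in>S. ennreal (f x) \<partial>lebesgue) = emeasure (density lborel g) S"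
    if strip: "unit_width_strip S" for S
  proof -
    obtain u a where "S = {x. a \<le> x \<bullet> u \<and> x \<bullet> u \<le> a + 1}"
      using strip unfolding unit_width_strip_def by blast
    then have S: "S \<in> sets lborel" by simp
    have "(\<integral>\<^sup>+x\<in>S. ennreal (f x) \<partial>lebesgue) = (\<integral>\<^sup>+x\<in>S. g x \<partial>lborel)"
      unfolding nn_integral_completion using fg by (intro nn_integral_cong_AE) auto
    then show ?thesis using g S by (simp add: emeasure_density)
  qed
  show False
    by (rule no_borel_density[of g m M]) (use g assms bounds eq in auto)
qed

end
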